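(* For every $\epsilon,\delta>0$ and every $0<\rho\le 1$ there exists a constant $c=c_{\epsilon,\delta,\rho}$ such that for all integers $\ell,n$ and every $\Delta\ge 0$ the following holds. There is a one-way protocol (Alice sends a single message to Bob) in which Alice and Bob have access to $\rho$-correlated random bits, such that for every input satisfying the promise of the uncertain compression problem $\textsc{Compress}^{\ell,n}_{\Delta,\delta}$, Bob outputs $m$ with probability at least $1-\delta$, and the expected number of bits communicated when $m\sim P$ is at most $$\frac{1+\epsilon}{1-h\left(\frac{1-\rho}{2}\right)}\Big(H(P)+2\Delta+c\Big).$$ In the paper's notation: $\mathrm{ISR}^{\mathrm{one\text{-}way}}_\rho\big(\textsc{Compress}^{\ell,n}_{\Delta,\delta}\big)\le \frac{1+\epsilon}{1-h((1-\rho)/2)}\big(H(P)+2\Delta+c\big)$.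
   Context: All logarithms are base 2. $h(x)=-x\log x-(1-x)\log(1-x)$ is the binary entropy function, and for a distribution $P$ on $[n]=\{1,\dots,n\}$, $H(P)=\sum_i P(i)\log(1/P(i))$. Imperfectly shared randomness: for $\rho\in[0,1]$, a pair of bits $(a,b)\in\{+1,-1\}^2$ is $\rho$-correlated if $\mathbb E[a]=\mathbb E[b]=0$ and $\mathbb E[ab]=\rho$. Alice receives an arbitrarily long sequence $r$ and Bob a sequence $r'$, where the pairs $(r_i,r'_i)$ are independent $\rho$-correlated pairs. For $\rho=1$ this is perfectly shared randomness. Uncertain compression problem $\textsc{Compress}^{\ell,n}_{\Delta,\delta}$ (with $\delta>0$, $\Delta\ge0$): Alice gets a probability distribution $P=(P_1,\dots,P_n)$ on $[n]$ and a message $m\in[n]$; Bob gets a probability distribution $Q$ on $[n]$. The promise is that $H(P)\le \ell$ and $|\log(P_i/Q_i)|\le\Delta$ for every $i\in[n]$. The goal is for Bob to output $m$ with probability at least $1-\delta$. The complexity measure $\mathrm{ISR}^{\mathrm{one\text{-}way}}_\rho$ is, for the best one-way protocol using $\rho$-correlated randomness, the maximum over $(P,Q)$ satisfying the promise of the expected communication when $m$ is sampled according to $P$. *)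

theory Defs
  imports "HOL-Probability.Probability"
begin

definition bin_entropy :: "real \<Rightarrow> real" where
  "bin_entropy x = - x * log 2 x - (1 - x) * log 2 (1 - x)"

definition distribution_on :: "nat \<Rightarrow> nat pmf \<Rightarrow> bool" where
  "distribution_on n P \<longleftrightarrow> set_pmf P \<subseteq> {1..n}"

definition shannon_entropy :: "nat \<Rightarrow> nat pmf \<Rightarrow> real" where
  "shannon_entropy n P = (\<Sum>i\<in>{1..n}. pmf P i * log 2 (1 / pmf P i))"

definition rho_correlated :: "real \<Rightarrow> (int \<times> int) pmf \<Rightarrow> bool" where
  "rho_correlated \<rho> D \<longleftrightarrow>
     set_pmf D \<subseteq> {1, -1} \<times> {1, -1} \<and>
     measure_pmf.expectation D (\<lambda>(a, b). real_of_int a) = 0 \<and>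
     measure_pmf.expectation D (\<lambda>(a, b). real_of_int b) = 0 \<and>
     measure_pmf.expectation D (\<lambda>(a, b). real_of_int (a * b)) = \<rho>"

lemma rho_correlated_pmf:
  assumes "rho_correlated \<rho> D"
  shows "pmf D (1, 1) = (1 + \<rho>) / 4" "pmf D (-1, -1) = (1 + \<rho>) / 4"
    "pmf D (1, -1) = (1 - \<rho>) / 4" "pmf D (-1, 1) = (1 - \<rho>) / 4"
proof -
  let ?S = "{1, -1} \<times> {1, -1} :: (int \<times> int) set"
  have S: "set_pmf D \<subseteq> ?S"
    using assms by (simp add: rho_correlated_def)
  have E: "measure_pmf.expectation D f = (\<Sum>x\<in>?S. pmf D x * f x)" for f :: "int \<times> int \<Rightarrow> real"
    using S by (subst integral_measure_pmf[of ?S]) auto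
  have 1: "(\<Sum>x\<in>?S. pmf D x) = 1"
    using S by (intro sum_pmf_eq_1) auto
  show "pmf D (1, 1) = (1 + \<rho>) / 4" "pmf D (-1, -1) = (1 + \<rho>) / 4"
    "pmf D (1, -1) = (1 - \<rho>) / 4" "pmf D (-1, 1) = (1 - \<rho>) / 4"
    using assms 1 by (auto simp: rho_correlated_def E simp flip: sum.cartesian_product)
qed

lemma rho_correlated_unique:
  assumes "rho_correlated \<rho> D" "rho_correlated \<rho> D'"
  shows "D = D'"
proof (rule pmf_eqI)
  fix x
  show "pmf D x = pmf D' x"
  proof (cases "x \<in> {1, -1} \<times> {1, -1}")
    case True
    then show ?thesis
      using rho_correlated_pmf[OF assms(1)] rho_correlated_pmf[OF assms(2)] by auto
  next
    case False
    then have "x \<notin> set_pmf D" "x \<notin> set_pmf D'"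
      using assms by (auto simp: rho_correlated_def)
    then show ?thesis by (simp add: set_pmf_iff)
  qed
qed

lemma rho_correlated_exists:
  assumes "0 \<le> \<rho>" "\<rho> \<le> 1"
  shows "\<exists>D. rho_correlated \<rho> D"
proof
  let ?D = "map_pmf (\<lambda>(a, e). (if a then 1 else -1, if a = e then 1 else -1))
    (pair_pmf (bernoulli_pmf (1/2)) (bernoulli_pmf ((1 + \<rho>) / 2))) :: (int \<times> int) pmf"
  have U: "(UNIV :: (bool \<times> bool) set) = {True, False} \<times> {True, False}"
    by auto
  have E: "measure_pmf.expectation ?D f =
      (\<Sum>(a, e)\<in>{True, False} \<times> {True, False}.
        pmf (bernoulli_pmf (1/2)) a * pmf (bernoulli_pmf ((1 + \<rho>) / 2)) e *
        f (if a then 1 else -1, if a = e then 1 else -1))" for f :: "int \<times> int \<Rightarrow> real"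
    by (subst integral_map_pmf, subst integral_measure_pmf[of UNIV])
      (auto simp: U pmf_pair simp flip: sum.cartesian_product)
  have "set_pmf ?D \<subseteq> {1, -1} \<times> {1, -1}"
    unfolding set_map_pmf by (rule image_subsetI) (simp split: prod.split)
  then show "rho_correlated \<rho> ?D"
    unfolding rho_correlated_def E
    using assms by (simp add: field_simps flip: sum.cartesian_product)
qed

text \<open>
  Alice and Bob jointly receive an infinite sequence of independent \<open>\<rho>\<close>-correlated pairs:
  Alice sees the first components, Bob the second ones.
\<close>

definition shared_randomness :: "(int \<times> int) pmf \<Rightarrow> (nat \<Rightarrow> int \<times> int) measure" where
  "shared_randomness D = PiM UNIV (\<lambda>_. measure_pmf D)"

abbreviation bit_sequences :: "(nat \<Rightarrow> int) measure" where
  "bit_sequences \<equiv> PiM UNIV (\<lambda>_. count_space UNIV)"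

text \<open>
  \<open>A P m r\<close> is the bit string Alice sends, \<open>B Q w r'\<close> is what Bob outputs on receiving \<open>w\<close>.
\<close>

type_synonym alice = "nat pmf \<Rightarrow> nat \<Rightarrow> (nat \<Rightarrow> int) \<Rightarrow> bool list"
type_synonym bob = "nat pmf \<Rightarrow> bool list \<Rightarrow> (nat \<Rightarrow> int) \<Rightarrow> nat"

definition one_way_protocol :: "alice \<Rightarrow> bob \<Rightarrow> bool" where
  "one_way_protocol A B \<longleftrightarrow>
     (\<forall>P m. A P m \<in> measurable bit_sequences (count_space UNIV)) \<and>
     (\<forall>Q w. B Q w \<in> measurable bit_sequences (count_space UNIV))"

definition success_prob ::
  "(int \<times> int) pmf \<Rightarrow> alice \<Rightarrow> bob \<Rightarrow> nat pmf \<Rightarrow> nat pmf \<Rightarrow> nat \<Rightarrow> real" where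
  "success_prob D A B P Q m =
     \<P>(\<omega> in shared_randomness D. B Q (A P m (fst \<circ> \<omega>)) (snd \<circ> \<omega>) = m)"

text \<open>
  A Lebesgue integral in \<open>ennreal\<close>, since the Bochner integral of a non-integrable length
  would be \<open>0\<close>.
\<close>

definition expected_communication :: "(int \<times> int) pmf \<Rightarrow> alice \<Rightarrow> nat pmf \<Rightarrow> ennreal" where
  "expected_communication D A P =
     (\<integral>\<^sup>+ m. (\<integral>\<^sup>+ \<omega>. of_nat (length (A P m (fst \<circ> \<omega>))) \<partial>shared_randomness D) \<partial>measure_pmf P)"

text \<open>
  The condition \<open>\<bar>log (P\<^sub>i / Q\<^sub>i)\<bar> \<le> \<Delta>\<close> forces \<open>P\<^sub>i\<close> and \<open>Q\<^sub>i\<close> to have the same support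
  (with \<open>0/0\<close> read as \<open>1\<close>); this is explicit below because \<open>x / 0 = 0\<close> and \<open>log 2 0 = 0\<close> in HOL.
\<close>

definition compress_promise :: "int \<Rightarrow> nat \<Rightarrow> real \<Rightarrow> nat pmf \<Rightarrow> nat pmf \<Rightarrow> bool" where
  "compress_promise l n \<Delta> P Q \<longleftrightarrow>
     distribution_on n P \<and> distribution_on n Q \<and>
     shannon_entropy n P \<le> real_of_int l \<and>
     (\<forall>i\<in>{1..n}. (pmf P i = 0 \<and> pmf Q i = 0) \<or>
        (pmf P i > 0 \<and> pmf Q i > 0 \<and> \<bar>log 2 (pmf P i / pmf Q i)\<bar> \<le> \<Delta>))"

end

theory Submission
  imports Defs "HOL-Real_Asymp.Real_Asymp"
begin

text \<open>
  Read the shared randomness as an independent random codeword for every message. Alice sends the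
  first \<open>k\<close> bits of the codeword of \<open>m\<close>, where \<open>k\<close> is about \<open>(log (1 / P(m)) + \<Delta> + c) / (1 - h(q))\<close>
  for some \<open>q\<close> slightly above the crossover probability \<open>p = (1 - \<rho>) / 2\<close>. From \<open>k\<close> Bob obtains
  a lower bound \<open>t\<close> on \<open>Q(m)\<close>, which leaves at most \<open>1 / t\<close> candidates; he picks one whose codeword
  is within Hamming distance \<open>q k\<close> of the received word. The true message passes this test by a
  Chernoff bound since \<open>p < q\<close>, and a wrong candidate passes with probability at most
  \<open>2 powr (- (1 - h(q)) k)\<close>, so a union bound over the candidates finishes the argument.
\<close>

subsection \<open>Hamming distance of correlated and independent codewords\<close>

lemma rho_correlated_expectation:
  assumes "rho_correlated \<rho> D"
  shows "measure_pmf.expectation D f =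
    (1 + \<rho>) / 4 * (f (1, 1) + f (-1, -1)) + (1 - \<rho>) / 4 * (f (1, -1) + f (-1, 1) :: real)"
proof -
  have "set_pmf D \<subseteq> {1, -1} \<times> {1, -1}"
    using assms by (simp add: rho_correlated_def)
  then have "measure_pmf.expectation D f = (\<Sum>x\<in>{1, -1} \<times> {1, -1}. pmf D x * f x)"
    by (subst integral_measure_pmf[of "{1, -1} \<times> {1, -1}"]) auto
  also have "\<dots> = (1 + \<rho>) / 4 * f (1, 1) + (1 - \<rho>) / 4 * f (1, -1) +
      ((1 - \<rho>) / 4 * f (-1, 1) + (1 + \<rho>) / 4 * f (-1, -1))"
    by (simp add: rho_correlated_pmf[OF assms] flip: sum.cartesian_product)
  finally show ?thesis
    by (simp only: distrib_left ac_simps)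
qed

lemma rho_correlated_prob:
  assumes "rho_correlated \<rho> D"
  shows "measure_pmf.prob D A =
    (1 + \<rho>) / 4 * (indicator A (1, 1) + indicator A (-1, -1)) +
    (1 - \<rho>) / 4 * (indicator A (1, -1) + indicator A (-1, 1))"
  using rho_correlated_expectation[OF assms, of "indicator A"] by simp

section \<open>The product measure of the shared randomness\<close>

lemma prob_space_shared_randomness: "prob_space (shared_randomness D)"
  unfolding shared_randomness_def by (rule prob_space_PiM) (rule measure_pmf.prob_space_axioms)

lemma space_shared_randomness [simp]: "space (shared_randomness D) = UNIV"
  by (simp add: shared_randomness_def space_PiM)

lemma sets_shared_randomness [measurable_cong]:
  "sets (shared_randomness D) = sets (PiM UNIV (\<lambda>_. count_space UNIV))"
  unfolding shared_randomness_def by (intro sets_PiM_cong) auto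

lemma measure_shared_randomness_Collect:
  assumes "finite J"
  shows "measure (shared_randomness D) {\<omega>. \<forall>i\<in>J. \<omega> i \<in> X i} = (\<Prod>i\<in>J. measure_pmf.prob D (X i))"
proof -
  interpret product_prob_space "\<lambda>_::nat. measure_pmf D" UNIV
    by (rule product_prob_spaceI) (rule measure_pmf.prob_space_axioms)
  have "emeasure (shared_randomness D) {\<omega>. \<forall>i\<in>J. \<omega> i \<in> X i} = (\<Prod>i\<in>J. emeasure (measure_pmf D) (X i))"
    using emeasure_PiM_Collect[of J X] assms by (simp add: shared_randomness_def space_PiM)
  then have "emeasure (shared_randomness D) {\<omega>. \<forall>i\<in>J. \<omega> i \<in> X i} =
      ennreal (\<Prod>i\<in>J. measure_pmf.prob D (X i))"
    by (simp add: measure_pmf.emeasure_eq_measure prod_ennreal)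
  then show ?thesis
    by (intro measure_eq_emeasure_eq_ennreal prod_nonneg) auto
qed

lemma distr_shared_randomness_coordinate:
  "distr (shared_randomness D) (count_space UNIV) (\<lambda>\<omega>. \<omega> i) = measure_pmf D"
proof -
  have "distr (shared_randomness D) (count_space UNIV) (\<lambda>\<omega>. \<omega> i) =
      distr (PiM UNIV (\<lambda>_. measure_pmf D)) (measure_pmf D) (\<lambda>\<omega>. \<omega> i)"
    unfolding shared_randomness_def by (intro distr_cong) auto
  also have "\<dots> = measure_pmf D"
    by (rule distr_PiM_component) (auto intro: measure_pmf.prob_space_axioms)
  finally show ?thesis .
qed

text \<open>The joint law of all coordinates is the law of the identity map, hence the measure
  itself, and this is the product of the coordinate laws.\<close>

lemma indep_vars_coordinates:
  "prob_space.indep_vars (shared_randomness D) (\<lambda>_. count_space UNIV) (\<lambda>i \<omega>. \<omega> i) (UNIV :: nat set)"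
proof -
  interpret prob_space "shared_randomness D"
    by (rule prob_space_shared_randomness)
  have "distr (shared_randomness D) (PiM UNIV (\<lambda>_. count_space UNIV)) (\<lambda>\<omega>. \<omega>) = shared_randomness D"
    by (intro distr_id2) (simp add: sets_shared_randomness)
  then show ?thesis
    by (subst indep_vars_iff_distr_eq_PiM)
      (simp_all add: distr_shared_randomness_coordinate restrict_UNIV flip: shared_randomness_def)
qed

lemma measurable_PiM_coordinate:
  assumes "i \<in> I"
  shows "(\<lambda>\<omega>. g (\<omega> i)) \<in> measurable (PiM I (\<lambda>_. count_space UNIV)) (count_space UNIV)"
  by (rule measurable_compose[OF measurable_component_singleton[OF assms]]) simp

text \<open>The codeword of message \<open>m\<close> occupies the positions
  \<open>prod_encode (m, j)\<close>, so distinct messages read disjoint parts of the sequence.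
  Alice's copy is read at \<open>m\<close> and Bob's at \<open>m'\<close>. Testing for
  \<open>= 1\<close> yields the Booleans that are transmitted.\<close>

definition differs :: "nat \<Rightarrow> nat \<Rightarrow> nat \<Rightarrow> (nat \<Rightarrow> int \<times> int) \<Rightarrow> bool" where
  "differs m m' j \<omega> \<longleftrightarrow> (fst (\<omega> (prod_encode (m, j))) = 1) \<noteq> (snd (\<omega> (prod_encode (m', j))) = 1)"

definition mismatches :: "nat \<Rightarrow> nat \<Rightarrow> nat \<Rightarrow> (nat \<Rightarrow> int \<times> int) \<Rightarrow> nat" where
  "mismatches m m' k \<omega> = card {j. j < k \<and> differs m m' j \<omega>}"

lemma measurable_differs [measurable]:
  "Measurable.pred (shared_randomness D) (differs m m' j)"
proof -
  note [measurable] = measurable_PiM_coordinate[OF UNIV_I]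
  show ?thesis
    unfolding differs_def by measurable
qed

lemma measurable_mismatches [measurable]:
  "mismatches m m' k \<in> measurable (shared_randomness D) (count_space UNIV)"
  unfolding mismatches_def by measurable

text \<open>For \<open>m = m'\<close> both bits come from one correlated pair and disagree with the
  crossover probability; otherwise they come from two independent pairs, and each is
  uniform.\<close>

lemma prob_differs:
  assumes "rho_correlated \<rho> D"
  shows "measure (shared_randomness D) {\<omega>. differs m m' j \<omega>} = (if m = m' then (1 - \<rho>) / 2 else 1 / 2)"
proof (cases "m = m'")
  case True
  have "{\<omega>. differs m m' j \<omega>} =
      {\<omega>. \<forall>i\<in>{prod_encode (m, j)}. \<omega> i \<in> {x. (fst x = 1) \<noteq> (snd x = 1)}}"
    using True by (auto simp: differs_def)
  then show ?thesis
    using True by (simp only: measure_shared_randomness_Collect finite.intros)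
      (simp add: rho_correlated_prob[OF assms])
next
  case False
  interpret prob_space "shared_randomness D"
    by (rule prob_space_shared_randomness)
  let ?a = "prod_encode (m, j)" and ?b = "prod_encode (m', j)"
  have ne: "?a \<noteq> ?b"
    using False by simp
  \<comment> \<open>Splitting on the value \<open>c\<close> of Alice's bit turns disagreement into
    two disjoint product events, each constraining the two coordinates separately.\<close>
  define X where "X c i = (if i = ?a then {x. (fst x = (1::int)) = c} else {x. (snd x = (1::int)) \<noteq> c})" for c i
  have split: "{\<omega>. differs m m' j \<omega>} =
      {\<omega>. \<forall>i\<in>{?a, ?b}. \<omega> i \<in> X True i} \<union> {\<omega>. \<forall>i\<in>{?a, ?b}. \<omega> i \<in> X False i}"
    using ne by (auto simp: differs_def X_def)
  have ev: "{\<omega>. \<forall>i\<in>{?a, ?b}. \<omega> i \<in> X c i} \<in> events" for c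
  proof -
    have "Measurable.pred (shared_randomness D) (\<lambda>\<omega>. \<forall>i\<in>{?a, ?b}. \<omega> i \<in> X c i)"
      by measurable
    then show ?thesis by (simp add: pred_def)
  qed
  have "prob {\<omega>. differs m m' j \<omega>} =
      prob {\<omega>. \<forall>i\<in>{?a, ?b}. \<omega> i \<in> X True i} + prob {\<omega>. \<forall>i\<in>{?a, ?b}. \<omega> i \<in> X False i}"
    unfolding split
    by (rule finite_measure_Union[OF ev ev]) (auto simp: X_def)
  also have "\<dots> = 1 / 4 + 1 / 4"
    using ne by (subst (1 2) measure_shared_randomness_Collect)
      (simp_all add: X_def rho_correlated_prob[OF assms] field_simps)
  finally show ?thesis
    using False by simp
qed

text \<open>This is the moment generating function with \<open>\<theta>\<close> in place of an
  exponential. The power is a product of one factor per position \<open>j\<close>, and different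
  \<open>j\<close> use disjoint coordinates, so the expectation factorizes.\<close>

lemma expectation_power_mismatches:
  fixes \<theta> :: real
  assumes "rho_correlated \<rho> D"
  shows "integrable (shared_randomness D) (\<lambda>\<omega>. \<theta> ^ mismatches m m' k \<omega>)"
    and "(\<integral>\<omega>. \<theta> ^ mismatches m m' k \<omega> \<partial>shared_randomness D) =
      (1 + (\<theta> - 1) * (if m = m' then (1 - \<rho>) / 2 else 1 / 2)) ^ k"
proof -
  interpret prob_space "shared_randomness D"
    by (rule prob_space_shared_randomness)
  let ?Z = "\<lambda>j \<omega>. if differs m m' j \<omega> then \<theta> else 1"
  \<comment> \<open>\<open>K j\<close> holds the coordinates read at position \<open>j\<close> (a
    single one if \<open>m = m'\<close>), and \<open>Y j\<close> is the factor as a function of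
    these alone, so that independence of disjoint blocks applies.\<close>
  define K where "K j = {prod_encode (m, j), prod_encode (m', j)}" for j
  define Y where "Y j f = (if (fst (f (prod_encode (m, j)) :: int \<times> int) = 1) \<noteq>
      (snd (f (prod_encode (m', j)) :: int \<times> int) = 1) then \<theta> else 1)" for j f
  have Z: "?Z j \<omega> = 1 + (\<theta> - 1) * indicator {\<omega>. differs m m' j \<omega>} \<omega>" for j \<omega>
    by (simp add: indicator_def)
  have ev [measurable]: "{\<omega>. differs m m' j \<omega>} \<in> events" for j
    using measurable_differs[where D = D] by (simp add: pred_def)
  have prod: "\<theta> ^ mismatches m m' k \<omega> = (\<Prod>j<k. ?Z j \<omega>)" for \<omega>
    by (subst prod.If_cases) (auto simp: mismatches_def Int_def)
  have "disjoint_family_on K {..<k}"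
    by (auto simp: disjoint_family_on_def K_def)
  then have "indep_vars (\<lambda>j. PiM (K j) (\<lambda>_. count_space UNIV)) (\<lambda>j \<omega>. restrict (\<lambda>i. \<omega> i) (K j)) {..<k}"
    by (intro indep_vars_restrict[OF indep_vars_coordinates]) auto
  moreover have "Y j \<in> borel_measurable (PiM (K j) (\<lambda>_. count_space UNIV))" for j
  proof -
    have [measurable]: "(\<lambda>f. g (f i)) \<in> measurable (PiM (K j) (\<lambda>_. count_space UNIV)) (count_space UNIV)"
      if "i \<in> K j" for i and g :: "int \<times> int \<Rightarrow> int"
      using that by (rule measurable_PiM_coordinate)
    have [measurable]: "prod_encode (m, j) \<in> K j" "prod_encode (m', j) \<in> K j"
      by (auto simp: K_def)
    show ?thesis
      unfolding Y_def by measurable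
  qed
  ultimately have "indep_vars (\<lambda>_. borel) (\<lambda>j \<omega>. Y j (restrict (\<lambda>i. \<omega> i) (K j))) {..<k}"
    by (rule indep_vars_compose2)
  also have "(\<lambda>j \<omega>. Y j (restrict (\<lambda>i. \<omega> i) (K j))) = ?Z"
    by (auto simp: fun_eq_iff Y_def K_def differs_def)
  finally have ind: "indep_vars (\<lambda>_. borel) ?Z {..<k}" .
  have int: "integrable (shared_randomness D) (?Z j)" for j
    unfolding Z by (auto intro!: integrable_add integrable_mult_right integrable_real_indicator
        simp: emeasure_eq_measure)
  have "(\<integral>\<omega>. ?Z j \<omega> \<partial>shared_randomness D) =
      1 + (\<theta> - 1) * (if m = m' then (1 - \<rho>) / 2 else 1 / 2)" for j
    unfolding Z by (subst Bochner_Integration.integral_add)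
      (auto intro!: integrable_mult_right integrable_real_indicator
        simp: emeasure_eq_measure prob_differs[OF assms] prob_space[simplified])
  then show "(\<integral>\<omega>. \<theta> ^ mismatches m m' k \<omega> \<partial>shared_randomness D) =
      (1 + (\<theta> - 1) * (if m = m' then (1 - \<rho>) / 2 else 1 / 2)) ^ k"
    unfolding prod using indep_vars_lebesgue_integral[OF _ ind int] by simp
  show "integrable (shared_randomness D) (\<lambda>\<omega>. \<theta> ^ mismatches m m' k \<omega>)"
    unfolding prod by (rule indep_vars_integrable[OF _ ind int]) simp
qed

text \<open>Markov's inequality for \<open>\<theta> ^ mismatches m m' k \<omega>\<close>. Stating
  the event through powers of \<open>\<theta>\<close> covers both tails:
  \<open>\<theta> \<ge> 1\<close> gives the upper one, \<open>\<theta> \<le> 1\<close> the lower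
  one.\<close>

lemma chernoff_mismatches:
  fixes \<theta> q :: real
  assumes "rho_correlated \<rho> D" "\<theta> > 0"
  shows "measure (shared_randomness D) {\<omega>. \<theta> powr (q * k) \<le> \<theta> ^ mismatches m m' k \<omega>}
    \<le> ((1 + (\<theta> - 1) * (if m = m' then (1 - \<rho>) / 2 else 1 / 2)) / \<theta> powr q) ^ k"
proof -
  have "measure (shared_randomness D) {\<omega>\<in>space (shared_randomness D). \<theta> powr (q * k) \<le> \<theta> ^ mismatches m m' k \<omega>}
      \<le> (\<integral>\<omega>. \<theta> ^ mismatches m m' k \<omega> \<partial>shared_randomness D) / \<theta> powr (q * k)"
    using assms by (intro integral_Markov_inequality_measure[where A = "{}"] expectation_power_mismatches(1)) auto
  moreover have "\<theta> powr (q * k) = (\<theta> powr q) ^ k"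
    using assms(2) by (simp add: powr_powr flip: powr_realpow)
  ultimately show ?thesis
    by (simp add: expectation_power_mismatches(2)[OF assms(1)] power_divide)
qed

lemma less_mismatches_prob:
  fixes \<theta> q :: real
  assumes "rho_correlated \<rho> D" "\<theta> \<ge> 1"
  shows "measure (shared_randomness D) {\<omega>. q * k < mismatches m m k \<omega>}
    \<le> ((1 + (\<theta> - 1) * ((1 - \<rho>) / 2)) / \<theta> powr q) ^ k"
proof -
  interpret prob_space "shared_randomness D"
    by (rule prob_space_shared_randomness)
  have ev: "{\<omega>. \<theta> powr (q * k) \<le> \<theta> powr real (mismatches m m k \<omega>)} \<in> events"
  proof -
    have "Measurable.pred (shared_randomness D) (\<lambda>\<omega>. \<theta> powr (q * k) \<le> \<theta> powr real (mismatches m m k \<omega>))"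
      by measurable
    then show ?thesis by (simp add: pred_def)
  qed
  have "prob {\<omega>. q * k < mismatches m m k \<omega>} \<le> prob {\<omega>. \<theta> powr (q * k) \<le> \<theta> ^ mismatches m m k \<omega>}"
    using assms(2) by (intro finite_measure_mono) (auto simp flip: powr_realpow intro!: powr_mono ev)
  then show ?thesis
    using chernoff_mismatches[OF assms(1), of \<theta> q k m m] assms(2) by simp
qed

text \<open>The optimal Chernoff parameter is \<open>\<theta> = q / (1 - q)\<close>.\<close>

lemma mismatches_le_prob:
  fixes q :: real
  assumes "rho_correlated \<rho> D" "0 < q" "q < 1 / 2" "m \<noteq> m'"
  shows "measure (shared_randomness D) {\<omega>. mismatches m m' k \<omega> \<le> q * k}
    \<le> 2 powr (- (1 - bin_entropy q) * k)"
proof -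
  interpret prob_space "shared_randomness D"
    by (rule prob_space_shared_randomness)
  define \<theta> where "\<theta> = q / (1 - q)"
  have \<theta>: "0 < \<theta>" "\<theta> \<le> 1" "1 + (\<theta> - 1) * (1 / 2) = 1 / (2 * (1 - q))"
    using assms by (auto simp: \<theta>_def field_simps)
  have \<theta>_log: "log 2 \<theta> = log 2 q - log 2 (1 - q)"
    using assms by (simp add: \<theta>_def log_divide)
  \<comment> \<open>At this \<open>\<theta>\<close> the base of the Chernoff bound for independent
    codewords is exactly 2 to the power \<open>- (1 - bin_entropy q)\<close>.\<close>
  have "2 powr (- (1 - bin_entropy q)) = 2 powr (- 1 - log 2 (1 - q) - q * log 2 \<theta>)"
    unfolding \<theta>_log bin_entropy_def by (simp add: algebra_simps)
  also have "\<dots> = 2 powr (- 1) / 2 powr (log 2 (1 - q)) / (2 powr (log 2 \<theta>)) powr q"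
    by (simp only: powr_diff powr_powr mult.commute)
  also have "\<dots> = 1 / (2 * (1 - q)) / \<theta> powr q"
    using assms \<theta> by (simp add: powr_minus_divide)
  finally have eq: "1 / (2 * (1 - q)) / \<theta> powr q = 2 powr (- (1 - bin_entropy q))" ..
  have ev: "{\<omega>. \<theta> powr (q * k) \<le> \<theta> powr real (mismatches m m' k \<omega>)} \<in> events"
  proof -
    have "Measurable.pred (shared_randomness D) (\<lambda>\<omega>. \<theta> powr (q * k) \<le> \<theta> powr real (mismatches m m' k \<omega>))"
      by measurable
    then show ?thesis by (simp add: pred_def)
  qed
  have "prob {\<omega>. mismatches m m' k \<omega> \<le> q * k} \<le> prob {\<omega>. \<theta> powr (q * k) \<le> \<theta> ^ mismatches m m' k \<omega>}"
    using \<theta> by (intro finite_measure_mono) (auto simp flip: powr_realpow intro!: powr_mono' ev)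
  also have "\<dots> \<le> (1 / (2 * (1 - q)) / \<theta> powr q) ^ k"
    using chernoff_mismatches[OF assms(1) \<theta>(1), of q k m m'] assms(4) \<theta>(3) by simp
  also have "\<dots> = 2 powr (- (1 - bin_entropy q) * k)"
    unfolding eq by (simp add: powr_powr flip: powr_realpow)
  finally show ?thesis .
qed

subsection \<open>Choice of the decoding radius\<close>

text \<open>One minus the entropy is the divergence of the distribution \<open>(x, 1 - x)\<close>
  from the uniform one. Applying \<open>ln y \<le> y - 1\<close> to both terms bounds it below by 0,
  strictly because \<open>1 / (2 * x)\<close> differs from 1.\<close>

lemma bin_entropy_less_1:
  assumes "0 \<le> x" "x < 1 / 2"
  shows "bin_entropy x < 1"
proof (cases "x = 0")
  case False
  then have x: "0 < x" "x < 1 / 2"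
    using assms by auto
  have "ln (1 / (2 * x)) < 1 / (2 * x) - 1"
    using ln_eq_minus_one[of "1 / (2 * x)"] ln_le_minus_one[of "1 / (2 * x)"] x by (force simp: field_simps)
  then have 1: "x * ln (1 / (2 * x)) < 1 / 2 - x"
    using x mult_strict_left_mono[of _ _ x] by (fastforce simp: field_simps)
  have "(1 - x) * ln (1 / (2 * (1 - x))) \<le> (1 - x) * (1 / (2 * (1 - x)) - 1)"
    using x by (intro mult_left_mono ln_le_minus_one) auto
  also have "\<dots> = x - 1 / 2"
    using x by (simp add: field_simps)
  finally have "x * ln (1 / (2 * x)) + (1 - x) * ln (1 / (2 * (1 - x))) < 0"
    using 1 by simp
  moreover have "ln (1 / (2 * x)) = - ln 2 - ln x" "ln (1 / (2 * (1 - x))) = - ln 2 - ln (1 - x)"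
    using x ln_mult_pos[of 2 x] ln_mult_pos[of 2 "1 - x"] by (simp_all add: ln_div)
  ultimately have "x * (- ln 2 - ln x) + (1 - x) * (- ln 2 - ln (1 - x)) < 0"
    by (simp only:)
  then have "- x * ln x - (1 - x) * ln (1 - x) < ln 2"
    by (simp add: algebra_simps)
  then show ?thesis
    by (simp add: bin_entropy_def log_def field_simps)
qed (simp add: bin_entropy_def)

text \<open>The radius approaches the crossover probability from above, and that probability is 0
  for \<open>\<rho> = 1\<close>. There the limit rests on \<open>x * log 2 x\<close> tending to
  0.\<close>

lemma bin_entropy_tendsto_at_right:
  assumes "0 \<le> x" "x < 1"
  shows "(bin_entropy \<longlongrightarrow> bin_entropy x) (at_right x)"
proof (cases "x = 0")
  case True
  have "((\<lambda>x::real. - x * log 2 x - (1 - x) * log 2 (1 - x)) \<longlongrightarrow> 0) (at_right 0)"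
    by real_asymp
  then show ?thesis
    using True by (simp add: bin_entropy_def[abs_def])
next
  case False
  then show ?thesis
    using assms unfolding bin_entropy_def by (auto intro!: tendsto_intros)
qed

text \<open>By continuity the inverse rate at \<open>q\<close> tends to the one at \<open>p\<close>
  as \<open>q\<close> decreases to \<open>p\<close>; the factor \<open>1 + \<epsilon>\<close> leaves
  room for some \<open>q\<close> strictly above \<open>p\<close>.\<close>

lemma exists_decoding_radius:
  assumes "0 < \<epsilon>" "0 \<le> p" "p < 1 / 2"
  obtains q where "p < q" "q < 1 / 2" "bin_entropy q < 1"
    "1 / (1 - bin_entropy q) \<le> (1 + \<epsilon>) / (1 - bin_entropy p)"
proof -
  have h: "bin_entropy p < 1"
    using assms by (intro bin_entropy_less_1)
  have "((\<lambda>q. 1 / (1 - bin_entropy q)) \<longlongrightarrow> 1 / (1 - bin_entropy p)) (at_right p)"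
    using h assms by (intro tendsto_intros bin_entropy_tendsto_at_right) auto
  moreover have "1 / (1 - bin_entropy p) < (1 + \<epsilon>) / (1 - bin_entropy p)"
    using h assms by (intro divide_strict_right_mono) auto
  ultimately have "eventually (\<lambda>q. 1 / (1 - bin_entropy q) < (1 + \<epsilon>) / (1 - bin_entropy p)) (at_right p)"
    by (rule order_tendstoD)
  moreover have "eventually (\<lambda>q. q \<in> {p<..<1/2}) (at_right p)"
    using assms by (intro eventually_at_right_real) auto
  ultimately have "eventually (\<lambda>q. p < q \<and> q < 1 / 2 \<and>
      1 / (1 - bin_entropy q) < (1 + \<epsilon>) / (1 - bin_entropy p)) (at_right p)"
    by eventually_elim auto
  then obtain q where "p < q \<and> q < 1 / 2 \<and> 1 / (1 - bin_entropy q) < (1 + \<epsilon>) / (1 - bin_entropy p)"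
    using eventually_happens trivial_limit_at_right_real by blast
  then show thesis
    using assms bin_entropy_less_1[of q] that[of q] by auto
qed

lemma exists_chernoff_parameter:
  fixes p q :: real
  assumes "0 \<le> p" "p < q"
  obtains \<theta> where "\<theta> \<ge> 1" "0 \<le> (1 + (\<theta> - 1) * p) / \<theta> powr q" "(1 + (\<theta> - 1) * p) / \<theta> powr q < 1"
proof -
  \<comment> \<open>By \<open>1 + x \<le> exp x\<close> and
    \<open>(\<theta> - 1) / \<theta> \<le> ln \<theta>\<close> it suffices that
    \<open>\<theta> > 1\<close> and \<open>p < q / \<theta>\<close>. This choice puts
    \<open>q / \<theta>\<close> at the midpoint of \<open>p\<close> and \<open>q\<close>, and it
    also works for \<open>p = 0\<close>.\<close>
  define \<theta> where "\<theta> = 2 * q / (p + q)"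
  have \<theta>: "\<theta> > 1" "q / \<theta> = (p + q) / 2"
    using assms by (auto simp: \<theta>_def field_simps)
  have "ln (1 / \<theta>) \<le> 1 / \<theta> - 1"
    using \<theta> by (intro ln_le_minus_one) simp
  then have "(\<theta> - 1) / \<theta> \<le> ln \<theta>"
    using \<theta> by (simp add: ln_div field_simps)
  then have "q * ((\<theta> - 1) / \<theta>) \<le> q * ln \<theta>"
    using assms by (intro mult_left_mono) auto
  moreover have "q * ((\<theta> - 1) / \<theta>) = (\<theta> - 1) * ((p + q) / 2)"
    unfolding \<theta>(2)[symmetric] by simp
  moreover have "(\<theta> - 1) * p < (\<theta> - 1) * ((p + q) / 2)"
    using \<theta> assms by (intro mult_strict_left_mono) auto
  ultimately have "(\<theta> - 1) * p < q * ln \<theta>"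
    by linarith
  then have "exp ((\<theta> - 1) * p) < \<theta> powr q"
    using \<theta> by (simp add: powr_def)
  moreover have "1 + (\<theta> - 1) * p \<le> exp ((\<theta> - 1) * p)"
    by (rule exp_ge_add_one_self)
  ultimately have "1 + (\<theta> - 1) * p < \<theta> powr q"
    by (rule order.strict_trans1[rotated])
  then have "(1 + (\<theta> - 1) * p) / \<theta> powr q < 1"
    using \<theta> by simp
  moreover have "0 \<le> (1 + (\<theta> - 1) * p) / \<theta> powr q"
    using \<theta> assms by simp
  ultimately show thesis
    using that[of \<theta>] \<theta> by simp
qed

subsection \<open>The random code protocol\<close>

text \<open>\<open>C\<close> will be the inverse of the rate \<open>1 - bin_entropy q\<close>, and
  \<open>s\<close> the slack \<open>\<Delta> + c\<close> on top of the ideal code length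
  \<open>log 2 (1 / x)\<close>.\<close>

definition block_length :: "real \<Rightarrow> real \<Rightarrow> real \<Rightarrow> nat" where
  "block_length C s x = nat \<lceil>C * (log 2 (1 / x) + s)\<rceil>"

text \<open>
  The first bit flags messages outside the support of \<open>P\<close>, which must be decoded correctly but
  cost nothing in expectation.
\<close>

definition random_encoder :: "real \<Rightarrow> real \<Rightarrow> alice" where
  "random_encoder C s P m r =
     (if pmf P m = 0 then False # replicate m False
      else True # map (\<lambda>j. r (prod_encode (m, j)) = 1) [0..<block_length C s (pmf P m)])"

text \<open>The threshold inverts the block length: a word of length \<open>k\<close> for
  \<open>m\<close> satisfies \<open>log 2 (1 / pmf P m) + \<Delta> + c \<le> k / C\<close>, and
  passing from \<open>P\<close> to \<open>Q\<close> costs at most \<open>\<Delta>\<close>. Bob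
  computes it from the length of the word alone.\<close>

definition candidate :: "real \<Rightarrow> real \<Rightarrow> real \<Rightarrow> nat pmf \<Rightarrow> bool list \<Rightarrow> (nat \<Rightarrow> int) \<Rightarrow> nat \<Rightarrow> bool" where
  "candidate q C c Q v r' m \<longleftrightarrow>
     2 powr (c - real (length v) / C) \<le> pmf Q m \<and>
     real (card {j. j < length v \<and> v ! j \<noteq> (r' (prod_encode (m, j)) = 1)}) \<le> q * real (length v)"

text \<open>\<open>LEAST\<close> only makes the choice definite: on the good event the true message
  is the sole candidate. A word with flag \<open>False\<close> is a message in unary.\<close>

definition ball_decoder :: "real \<Rightarrow> real \<Rightarrow> real \<Rightarrow> bob" where
  "ball_decoder q C c Q w r' =
     (if w \<noteq> [] \<and> hd w then LEAST m. candidate q C c Q (tl w) r' m else length (tl w))"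

section \<open>Measurability of the protocol\<close>

lemma measurable_random_encoder:
  "random_encoder C s P m \<in> measurable bit_sequences (count_space UNIV)"
proof -
  have map: "(\<lambda>r. map (\<lambda>j. r (prod_encode (m, j)) = 1) xs) \<in> measurable bit_sequences (count_space UNIV)" for xs
  proof (induction xs)
    case (Cons x xs)
    have "(\<lambda>r. r (prod_encode (m, x)) = 1) \<in> measurable bit_sequences (count_space UNIV)"
      by (rule measurable_PiM_coordinate) simp
    \<comment> \<open>The new head takes only two values, so measurability for each fixed head is
      enough.\<close>
    from measurable_compose_countable[where f = "\<lambda>b r. b # map (\<lambda>j. r (prod_encode (m, j)) = 1) xs", OF _ this]
      measurable_compose[OF Cons.IH, of "(#) b" "count_space UNIV" for b]
    show ?case by simp
  qed simp
  show ?thesis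
    unfolding random_encoder_def[abs_def]
    using measurable_compose[OF map, of "(#) True" "count_space UNIV"] by simp
qed

lemma measurable_ball_decoder:
  "ball_decoder q C c Q w \<in> measurable bit_sequences (count_space UNIV)"
proof -
  note [measurable] = measurable_PiM_coordinate[OF UNIV_I]
  have [measurable]: "Measurable.pred bit_sequences (\<lambda>r. candidate q C c Q v r m)" for v m
    unfolding candidate_def by measurable
  show ?thesis
    unfolding ball_decoder_def[abs_def] by measurable
qed

lemma one_way_protocol_random_code: "one_way_protocol (random_encoder C s) (ball_decoder q C c)"
  by (simp add: one_way_protocol_def measurable_random_encoder measurable_ball_decoder)

lemma measurable_map_shared_randomness:
  "(\<lambda>\<omega>. f \<circ> \<omega>) \<in> measurable (shared_randomness D) bit_sequences"
proof (rule measurable_PiM_single')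
  note [measurable] = measurable_PiM_coordinate[OF UNIV_I]
  show "(\<lambda>\<omega>. (f \<circ> \<omega>) i) \<in> measurable (shared_randomness D) (count_space UNIV)" for i
    unfolding comp_def by measurable
qed auto

text \<open>Bob's output is measurable only for each fixed word, but there are countably many words,
  so the composition with Alice's random word is measurable too.\<close>

lemma success_event:
  assumes "one_way_protocol A B"
  shows "{\<omega>. B Q (A P m (fst \<circ> \<omega>)) (snd \<circ> \<omega>) = m'} \<in> sets (shared_randomness D)"
proof -
  have A: "A P m \<in> measurable bit_sequences (count_space UNIV)"
    and B: "B Q w \<in> measurable bit_sequences (count_space UNIV)" for w
    using assms by (auto simp: one_way_protocol_def)
  have "(\<lambda>\<omega>. A P m (fst \<circ> \<omega>)) \<in> measurable (shared_randomness D) (count_space UNIV)"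
    "(\<lambda>\<omega>. B Q w (snd \<circ> \<omega>)) \<in> measurable (shared_randomness D) (count_space UNIV)" for w
    by (rule measurable_compose[OF measurable_map_shared_randomness A]
        measurable_compose[OF measurable_map_shared_randomness B])+
  then have [measurable]:
    "(\<lambda>\<omega>. B Q (A P m (fst \<circ> \<omega>)) (snd \<circ> \<omega>)) \<in> measurable (shared_randomness D) (count_space UNIV)"
    by (rule measurable_compose_countable[rotated])
  have "Measurable.pred (shared_randomness D) (\<lambda>\<omega>. B Q (A P m (fst \<circ> \<omega>)) (snd \<circ> \<omega>) = m')"
    by measurable
  then show ?thesis
    by (simp add: pred_def)
qed

section \<open>Probability of correct decoding\<close>

lemma card_likely_le:
  fixes Q :: "'a pmf" and t :: real
  assumes "finite (set_pmf Q)" "0 < t"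
  shows "finite {x. t \<le> pmf Q x}" "card {x. t \<le> pmf Q x} * t \<le> 1"
proof -
  have sub: "{x. t \<le> pmf Q x} \<subseteq> set_pmf Q"
    using assms(2) by (auto simp: set_pmf_iff)
  then show fin: "finite {x. t \<le> pmf Q x}"
    using assms(1) finite_subset by blast
  have "card {x. t \<le> pmf Q x} * t \<le> (\<Sum>x\<in>{x. t \<le> pmf Q x}. pmf Q x)"
    by (rule sum_bounded_below) simp
  also have "\<dots> = measure_pmf.prob Q {x. t \<le> pmf Q x}"
    using fin by (simp add: measure_measure_pmf_finite)
  finally show "card {x. t \<le> pmf Q x} * t \<le> 1"
    using measure_pmf.prob_le_1 order_trans by blast
qed

lemma block_length_bounds:
  assumes "0 < C" "0 \<le> s" "0 < x" "x \<le> 1"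
  shows "C * (log 2 (1 / x) + s) \<le> block_length C s x"
    and "block_length C s x \<le> C * (log 2 (1 / x) + s) + 1"
proof -
  \<comment> \<open>Nonnegativity keeps \<open>nat\<close> from lifting a negative ceiling to 0,
    which could break the upper bound.\<close>
  have "0 \<le> C * (log 2 (1 / x) + s)"
    using assms by (intro mult_nonneg_nonneg add_nonneg_nonneg) auto
  then show "C * (log 2 (1 / x) + s) \<le> block_length C s x"
    "block_length C s x \<le> C * (log 2 (1 / x) + s) + 1"
    unfolding block_length_def by linarith+
qed

text \<open>The error budget is split evenly: \<open>\<delta> / 2\<close> for the true codeword
  being too far from the received word, which is the assumption \<open>close\<close>, and
  \<open>\<delta> / 2\<close> for some wrong candidate being near it.\<close>

lemma success_prob_random_code:
  assumes D: "rho_correlated \<rho> D"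
    and q: "0 < q" "q < 1 / 2" "bin_entropy q < 1"
    and C: "C = 1 / (1 - bin_entropy q)"
    and c: "0 \<le> c" "2 powr (- c) \<le> \<delta> / 2"
    and close: "\<And>k. C * c \<le> real k \<Longrightarrow>
      measure (shared_randomness D) {\<omega>. q * k < mismatches m m k \<omega>} \<le> \<delta> / 2"
    and \<Delta>: "0 \<le> \<Delta>"
    and promise: "compress_promise l n \<Delta> P Q" and m: "m \<in> {1..n}"
  shows "1 - \<delta> \<le> success_prob D (random_encoder C (\<Delta> + c)) (ball_decoder q C c) P Q m"
proof (cases "pmf P m = 0")
  case True
  interpret prob_space "shared_randomness D"
    by (rule prob_space_shared_randomness)
  have "0 < 2 powr (- c)" by simp
  then have "0 \<le> \<delta>" using c by linarith
  then show ?thesis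
    using True prob_space by (simp add: success_prob_def random_encoder_def ball_decoder_def)
next
  case False
  interpret prob_space "shared_randomness D"
    by (rule prob_space_shared_randomness)
  define k where "k = block_length C (\<Delta> + c) (pmf P m)"
  define t where "t = 2 powr (c - k / C)"
  define T where "T = {m'. t \<le> pmf Q m'} - {m}"
  define far where "far = {\<omega>. q * k < mismatches m m k \<omega>}"
  define near where "near m' = {\<omega>. mismatches m m' k \<omega> \<le> q * k}" for m'
  let ?A = "random_encoder C (\<Delta> + c)" and ?B = "ball_decoder q C c"
  have C0: "0 < C"
    using q C by simp
  have P: "0 < pmf P m" "pmf P m \<le> 1"
    using False by (auto simp: pmf_le_1 pmf_pos)
  have "(pmf P m = 0 \<and> pmf Q m = 0) \<or>
      (pmf P m > 0 \<and> pmf Q m > 0 \<and> \<bar>log 2 (pmf P m / pmf Q m)\<bar> \<le> \<Delta>)"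
    using promise m unfolding compress_promise_def by blast
  then have Q: "0 < pmf Q m" "log 2 (pmf P m / pmf Q m) \<le> \<Delta>"
    using P by auto
  have k: "C * (log 2 (1 / pmf P m) + (\<Delta> + c)) \<le> k"
    unfolding k_def using C0 c \<Delta> P by (intro block_length_bounds) auto
  have "0 \<le> log 2 (1 / pmf P m)"
    using P by simp
  \<comment> \<open>The slack \<open>c\<close> alone makes the block long enough for
    \<open>close\<close>, even if \<open>pmf P m = 1\<close>.\<close>
  then have "C * c \<le> C * (log 2 (1 / pmf P m) + (\<Delta> + c))"
    using C0 \<Delta> by (intro mult_left_mono) auto
  then have far_le: "prob far \<le> \<delta> / 2"
    unfolding far_def using k by (intro close) linarith
  \<comment> \<open>The block length already includes the \<open>\<Delta>\<close> lost in replacing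
    \<open>P\<close> by \<open>Q\<close>, so \<open>m\<close> clears Bob's threshold.\<close>
  have "log 2 (1 / pmf P m) + (\<Delta> + c) \<le> k / C"
    using k C0 by (simp add: field_simps)
  then have "c - k / C \<le> log 2 (pmf Q m)"
    using Q P by (simp add: log_divide)
  then have Qm: "t \<le> pmf Q m"
    using Q(1) by (simp add: t_def le_log_iff)
  have "set_pmf Q \<subseteq> {1..n}"
    using promise by (simp add: compress_promise_def distribution_on_def)
  then have finQ: "finite (set_pmf Q)"
    using finite_subset by blast
  have "0 < t" by (simp add: t_def)
  note likely = card_likely_le[OF finQ this]
  have T: "finite T" "card T * t \<le> 1"
  proof -
    show "finite T"
      using likely(1) by (simp add: T_def)
    have "card T \<le> card {x. t \<le> pmf Q x}"
      unfolding T_def by (intro card_mono likely(1)) auto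
    then have "card T * t \<le> card {x. t \<le> pmf Q x} * t"
      using \<open>0 < t\<close> by (intro mult_right_mono) auto
    then show "card T * t \<le> 1"
      using likely(2) by linarith
  qed
  have mism: "card {j. j < k \<and> map (\<lambda>j. (fst \<circ> \<omega>) (prod_encode (m, j)) = 1) [0..<k] ! j
      \<noteq> ((snd \<circ> \<omega>) (prod_encode (m', j)) = 1)} = mismatches m m' k \<omega>" for \<omega> m'
    unfolding mismatches_def differs_def by (intro arg_cong[where f = card]) auto
  have decode: "?B Q (?A P m (fst \<circ> \<omega>)) (snd \<circ> \<omega>) =
      (LEAST m'. t \<le> pmf Q m' \<and> mismatches m m' k \<omega> \<le> q * k)" for \<omega>
  proof -
    let ?v = "map (\<lambda>j. (fst \<circ> \<omega>) (prod_encode (m, j)) = 1) [0..<k]"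
    have "candidate q C c Q ?v (snd \<circ> \<omega>) = (\<lambda>m'. t \<le> pmf Q m' \<and> mismatches m m' k \<omega> \<le> q * k)"
      by (rule ext) (simp only: candidate_def length_map length_upt diff_zero mism t_def)
    moreover have "?A P m (fst \<circ> \<omega>) = True # ?v"
      using False by (simp add: random_encoder_def k_def)
    ultimately show ?thesis
      by (simp add: ball_decoder_def)
  qed
  have correct: "?B Q (?A P m (fst \<circ> \<omega>)) (snd \<circ> \<omega>) = m"
    if "\<omega> \<notin> far" "\<omega> \<notin> (\<Union>m'\<in>T. near m')" for \<omega>
    unfolding decode
  proof (rule Least_equality)
    show "t \<le> pmf Q m \<and> mismatches m m k \<omega> \<le> q * k"
      using Qm that(1) by (simp add: far_def)
    show "m \<le> m'" if "t \<le> pmf Q m' \<and> mismatches m m' k \<omega> \<le> q * k" for m'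
      using that \<open>\<omega> \<notin> (\<Union>m'\<in>T. near m')\<close> by (cases "m' = m") (auto simp: T_def near_def)
  qed
  have far_ev: "far \<in> events"
  proof -
    have "Measurable.pred (shared_randomness D) (\<lambda>\<omega>. q * k < mismatches m m k \<omega>)"
      by measurable
    then show ?thesis by (simp add: far_def pred_def)
  qed
  have near_ev: "near m' \<in> events" for m'
  proof -
    have "Measurable.pred (shared_randomness D) (\<lambda>\<omega>. mismatches m m' k \<omega> \<le> q * k)"
      by measurable
    then show ?thesis by (simp add: near_def pred_def)
  qed
  have "prob (\<Union>m'\<in>T. near m') \<le> (\<Sum>m'\<in>T. prob (near m'))"
    using T(1) near_ev by (intro finite_measure_subadditive_finite) auto
  also have "\<dots> \<le> (\<Sum>m'\<in>T. 2 powr (- (1 - bin_entropy q) * k))"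
    unfolding near_def using D q by (intro sum_mono mismatches_le_prob) (auto simp: T_def)
  \<comment> \<open>The exponent is split so that each summand becomes
    \<open>t * 2 powr (- c)\<close>: the factor \<open>t\<close> cancels against the at most
    \<open>1 / t\<close> wrong candidates, and \<open>2 powr (- c)\<close> remains.\<close>
  also have "- (1 - bin_entropy q) * k = (c - k / C) - c"
    by (simp add: C algebra_simps)
  also have "(\<Sum>m'\<in>T. 2 powr (c - k / C - c)) = card T * t * 2 powr (- c)"
    by (simp add: t_def powr_diff powr_minus_divide)
  also have "\<dots> \<le> 1 * (\<delta> / 2)"
    using T(2) c(2) \<open>0 < t\<close> by (intro mult_mono) auto
  finally have near_le: "prob (\<Union>m'\<in>T. near m') \<le> \<delta> / 2"
    by simp
  let ?bad = "far \<union> (\<Union>m'\<in>T. near m')"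
  have near_Un: "(\<Union>m'\<in>T. near m') \<in> events"
    using T(1) near_ev by (intro sets.finite_UN) auto
  have "1 - \<delta> \<le> 1 - (prob far + prob (\<Union>m'\<in>T. near m'))"
    using far_le near_le by simp
  also have "\<dots> \<le> 1 - prob ?bad"
    using measure_Un_le[OF far_ev near_Un] by simp
  also have "\<dots> = prob (space (shared_randomness D) - ?bad)"
    using far_ev near_Un by (intro prob_compl[symmetric]) auto
  also have "\<dots> \<le> prob {\<omega>. ?B Q (?A P m (fst \<circ> \<omega>)) (snd \<circ> \<omega>) = m}"
    by (rule finite_measure_mono[OF _ success_event[OF one_way_protocol_random_code]])
      (use correct in auto)
  finally show ?thesis
    by (simp add: success_prob_def)
qed

section \<open>Expected message length\<close>

lemma shannon_entropy_nonneg: "0 \<le> shannon_entropy n P"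
  unfolding shannon_entropy_def
proof (rule sum_nonneg)
  show "0 \<le> pmf P i * log 2 (1 / pmf P i)" for i
    by (cases "pmf P i = 0") (auto simp: pmf_le_1 pmf_pos)
qed

text \<open>The length depends on the message but not on the randomness. Averaging
  \<open>C * log 2 (1 / pmf P m)\<close> gives the entropy term; the additive 2 is one flag bit and
  one bit of rounding.\<close>

lemma expected_communication_random_encoder:
  assumes P: "distribution_on n P" and C: "0 < C" and s: "0 \<le> s"
  shows "expected_communication D (random_encoder C s) P \<le> ennreal (C * (shannon_entropy n P + s) + 2)"
proof -
  interpret prob_space "shared_randomness D"
    by (rule prob_space_shared_randomness)
  have P: "set_pmf P \<subseteq> {1..n}"
    using P by (simp add: distribution_on_def)
  then have fin: "finite (set_pmf P)"
    using finite_subset by blast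
  let ?L = "\<lambda>m. block_length C s (pmf P m) + 1"
  have "expected_communication D (random_encoder C s) P =
      (\<Sum>m\<in>set_pmf P. (\<integral>\<^sup>+ \<omega>. of_nat (length (random_encoder C s P m (fst \<circ> \<omega>))) \<partial>shared_randomness D) * pmf P m)"
    unfolding expected_communication_def using fin by (rule nn_integral_measure_pmf_finite) simp
  also have "\<dots> = (\<Sum>m\<in>set_pmf P. ennreal (real (?L m) * pmf P m))"
  proof (rule sum.cong[OF refl])
    fix m assume "m \<in> set_pmf P"
    then have "length (random_encoder C s P m r) = ?L m" for r
      by (simp add: random_encoder_def set_pmf_iff)
    then show "(\<integral>\<^sup>+ \<omega>. of_nat (length (random_encoder C s P m (fst \<circ> \<omega>))) \<partial>shared_randomness D) * pmf P m
        = ennreal (real (?L m) * pmf P m)"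
      using emeasure_space_1 by (simp add: ennreal_mult ennreal_of_nat_eq_real_of_nat del: of_nat_add of_nat_Suc)
  qed
  also have "\<dots> = ennreal (\<Sum>m\<in>set_pmf P. real (?L m) * pmf P m)"
    by (rule sum_ennreal) simp
  also have "\<dots> = ennreal (\<Sum>m\<in>{1..n}. real (?L m) * pmf P m)"
    using P by (intro arg_cong[where f = ennreal] sum.mono_neutral_left) (auto simp: set_pmf_iff)
  also have "\<dots> \<le> ennreal (\<Sum>m\<in>{1..n}. C * (pmf P m * log 2 (1 / pmf P m)) + (C * s + 2) * pmf P m)"
  proof (intro ennreal_leI sum_mono)
    fix m
    show "real (?L m) * pmf P m \<le> C * (pmf P m * log 2 (1 / pmf P m)) + (C * s + 2) * pmf P m"
    proof (cases "pmf P m = 0")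
      case False
      then have "real (?L m) \<le> C * (log 2 (1 / pmf P m) + s) + 2"
        using block_length_bounds(2)[OF C s, of "pmf P m"] by (simp add: pmf_pos pmf_le_1)
      then have "real (?L m) * pmf P m \<le> (C * (log 2 (1 / pmf P m) + s) + 2) * pmf P m"
        by (rule mult_right_mono) simp
      then show ?thesis
        by (simp only: distrib_left distrib_right ac_simps)
    qed simp
  qed
  also have "(\<Sum>m\<in>{1..n}. C * (pmf P m * log 2 (1 / pmf P m)) + (C * s + 2) * pmf P m)
      = C * shannon_entropy n P + (C * s + 2) * (\<Sum>m\<in>{1..n}. pmf P m)"
    by (simp only: sum.distrib shannon_entropy_def sum_distrib_left)
  also have "(\<Sum>m\<in>{1..n}. pmf P m) = 1"
    using P by (intro sum_pmf_eq_1) auto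
  finally show ?thesis
    by (simp add: algebra_simps)
qed

section \<open>Choice of the constants and the final bound\<close>

theorem theorem2p3:
  fixes \<epsilon> \<delta> \<rho> :: real
  assumes "\<epsilon> > 0" and "\<delta> > 0" and "0 < \<rho>" and "\<rho> \<le> 1"
  shows "\<exists>c :: real. \<forall>(l :: int) (n :: nat) (\<Delta> :: real). \<Delta> \<ge> 0 \<longrightarrow>
    (\<exists>A B. one_way_protocol A B \<and>
      (\<forall>D P Q. rho_correlated \<rho> D \<longrightarrow> compress_promise l n \<Delta> P Q \<longrightarrow>
        (\<forall>m\<in>{1..n}. success_prob D A B P Q m \<ge> 1 - \<delta>) \<and>
        expected_communication D A P \<le>
          ennreal ((1 + \<epsilon>) / (1 - bin_entropy ((1 - \<rho>) / 2)) *
            (shannon_entropy n P + 2 * \<Delta> + c))))"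
proof -
  define p where "p = (1 - \<rho>) / 2"
  have p: "0 \<le> p" "p < 1 / 2"
    using assms by (auto simp: p_def)
  obtain q where q: "p < q" "q < 1 / 2" "bin_entropy q < 1"
    and rate: "1 / (1 - bin_entropy q) \<le> (1 + \<epsilon>) / (1 - bin_entropy p)"
    using exists_decoding_radius[OF assms(1) p] .
  obtain \<theta> where \<theta>: "\<theta> \<ge> 1" "0 \<le> (1 + (\<theta> - 1) * p) / \<theta> powr q" "(1 + (\<theta> - 1) * p) / \<theta> powr q < 1"
    using exists_chernoff_parameter[OF p(1) q(1)] .
  define \<beta> where "\<beta> = (1 + (\<theta> - 1) * p) / \<theta> powr q"
  define C where "C = 1 / (1 - bin_entropy q)"
  define C' where "C' = (1 + \<epsilon>) / (1 - bin_entropy p)"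
  have C: "0 < C" "C \<le> C'"
    using q rate by (auto simp: C_def C'_def)
  have "(\<lambda>k. \<beta> ^ k) \<longlonglongrightarrow> 0"
    using \<theta> by (intro LIMSEQ_realpow_zero) (auto simp: \<beta>_def)
  then have "eventually (\<lambda>k. \<beta> ^ k < \<delta> / 2) sequentially"
    using assms by (intro order_tendstoD) auto
  then obtain N where N: "\<And>k. N \<le> k \<Longrightarrow> \<beta> ^ k < \<delta> / 2"
    by (auto simp: eventually_sequentially)
  \<comment> \<open>The first term makes every block at least \<open>N\<close> long, so that the
    Chernoff tail is below \<open>\<delta> / 2\<close>; the second makes
    \<open>2 powr (- c) \<le> \<delta> / 2\<close> for the union bound.\<close>
  define c where "c = max (N / C) (log 2 (2 / \<delta>))"
  have c: "0 \<le> c" "N / C \<le> c" "log 2 (2 / \<delta>) \<le> c"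
    using C by (auto simp: c_def le_max_iff_disj)
  have "2 powr (- c) \<le> 2 powr (- log 2 (2 / \<delta>))"
    using c by (intro powr_mono) auto
  also have "\<dots> = \<delta> / 2"
    using assms by (simp add: powr_minus)
  finally have c_small: "2 powr (- c) \<le> \<delta> / 2" .
  have close: "measure (shared_randomness D) {\<omega>. q * k < mismatches m m k \<omega>} \<le> \<delta> / 2"
    if "rho_correlated \<rho> D" "C * c \<le> real k" for D m k
  proof -
    have "N \<le> C * c"
      using c(2) C by (simp add: field_simps)
    then have "\<beta> ^ k \<le> \<delta> / 2"
      using that by (intro less_imp_le[OF N]) linarith
    then show ?thesis
      using less_mismatches_prob[OF that(1) \<theta>(1), of q k m] by (simp add: \<beta>_def p_def)
  qed
  \<comment> \<open>The constant of the theorem is \<open>c + 2 / C'\<close>: after multiplication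
    by \<open>C'\<close> its second term pays for the flag and the rounding.\<close>
  have "\<exists>A B. one_way_protocol A B \<and>
      (\<forall>D P Q. rho_correlated \<rho> D \<longrightarrow> compress_promise l n \<Delta> P Q \<longrightarrow>
        (\<forall>m\<in>{1..n}. success_prob D A B P Q m \<ge> 1 - \<delta>) \<and>
        expected_communication D A P \<le> ennreal (C' * (shannon_entropy n P + 2 * \<Delta> + (c + 2 / C'))))"
    if \<Delta>: "0 \<le> \<Delta>" for l n \<Delta>
  proof (intro exI conjI allI impI ballI)
    show "one_way_protocol (random_encoder C (\<Delta> + c)) (ball_decoder q C c)"
      by (rule one_way_protocol_random_code)
    fix D P Q
    assume D: "rho_correlated \<rho> D" and promise: "compress_promise l n \<Delta> P Q"
    show "1 - \<delta> \<le> success_prob D (random_encoder C (\<Delta> + c)) (ball_decoder q C c) P Q m"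
      if "m \<in> {1..n}" for m
      using p q by (intro success_prob_random_code[OF D _ _ _ C_def c(1) c_small close[OF D] \<Delta> promise that]) auto
    \<comment> \<open>The bracket is nonnegative, so \<open>C\<close> may grow to \<open>C'\<close>
      and \<open>\<Delta>\<close> to \<open>2 * \<Delta>\<close> at once.\<close>
    have "C * (shannon_entropy n P + (\<Delta> + c)) + 2 \<le> C' * (shannon_entropy n P + (2 * \<Delta> + c)) + 2"
      using C \<Delta> c(1) shannon_entropy_nonneg[of n P] by (intro add_right_mono mult_mono) auto
    also have "\<dots> = C' * (shannon_entropy n P + 2 * \<Delta> + (c + 2 / C'))"
      using C by (simp add: field_simps)
    finally have "ennreal (C * (shannon_entropy n P + (\<Delta> + c)) + 2)
        \<le> ennreal (C' * (shannon_entropy n P + 2 * \<Delta> + (c + 2 / C')))"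
      by (rule ennreal_leI)
    moreover have "expected_communication D (random_encoder C (\<Delta> + c)) P
        \<le> ennreal (C * (shannon_entropy n P + (\<Delta> + c)) + 2)"
      using promise C(1) \<Delta> c(1)
      by (intro expected_communication_random_encoder) (auto simp: compress_promise_def)
    ultimately show "expected_communication D (random_encoder C (\<Delta> + c)) P
        \<le> ennreal (C' * (shannon_entropy n P + 2 * \<Delta> + (c + 2 / C')))"
      by (rule order_trans[rotated])
  qed
  then show ?thesis
    unfolding C'_def p_def by blast
qed

end
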